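(* Let $(X,\|\cdot\|)$ be a complex normed space and let $x,y\in X\setminus\{0\}$. Suppose the angle is purely real, $\angle(x,y)=\frac{\pi}{2}+a$ with $-\frac{\pi}{2}\le a\le\frac{\pi}{2}$. Then $\angle(ix,y)$ is a complex angle with real part $\frac{\pi}{2}$, namely $$\angle(ix,y)=\frac{\pi}{2}+i\cdot\frac12\cdot\operatorname{sgn}(a)\cdot\operatorname{arcosh}\Big(2\cos^2\!\big(\tfrac{\pi}{2}+a\big)+1\Big)=\frac{\pi}{2}+i\cdot\operatorname{sgn}(a)\cdot\log\Big[\sqrt{\cos^2\!\big(\tfrac{\pi}{2}+a\big)+1}+\big|\cos\!\big(\tfrac{\pi}{2}+a\big)\big|\Big].$$
   Context: Let $(X,\|\cdot\|)$ be a complex normed vector space and let $i$ be the imaginary unit. The product $\langle\cdot\,|\,\cdot\rangle:X\times X\to\mathbb C$ is defined as follows: $\langle x|y\rangle:=0$ if $x=0$ or $y=0$, and otherwise $$\langle x|y\rangle:=\|x\|\,\|y\|\cdot\tfrac14\Big[\big\|\tfrac{x}{\|x\|}+\tfrac{y}{\|y\|}\big\|^2-\big\|\tfrac{x}{\|x\|}-\tfrac{y}{\|y\|}\big\|^2+i\Big(\big\|\tfrac{x}{\|x\|}+i\tfrac{y}{\|y\|}\big\|^2-\big\|\tfrac{x}{\|x\|}-i\tfrac{y}{\|y\|}\big\|^2\Big)\Big].$$ Let $\mathcal A:=\{a+ib\mid 0<a<\pi,\ b\in\mathbb R\}\cup\{0,\pi\}$ and $\mathcal B:=\mathbb C\setminus\{r\in\mathbb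 R\mid r<-1\text{ or }r>1\}$. The complex cosine restricts to a homeomorphism $\cos:\mathcal A\to\mathcal B$, and $\arccos:\mathcal B\to\mathcal A$ denotes its inverse. For $x,y\in X\setminus\{0\}$ the angle is the complex number $\angle(x,y):=\arccos\big(\langle x|y\rangle/(\|x\|\,\|y\|)\big)\in\mathcal A$ (the argument always lies in $\mathcal B$). Further, $\operatorname{arcosh}(t)=\log(t+\sqrt{t^2-1})$ for real $t\ge1$, and $\operatorname{sgn}(0)=0$, $\operatorname{sgn}(t)=1$ for $t>0$, $\operatorname{sgn}(t)=-1$ for $t<0$. *)

theory Defs
  imports "HOL-Analysis.Analysis"
begin

text \<open>Complex normed vector spaces, obtained from the library class of real normed vector spaces by
  adding a complex scalar multiplication. The law \<open>scaleC 1 x = x\<close> is not listed, since it follows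
  from the compatibility with the real scalar multiplication.\<close>

class complex_normed_vector = real_normed_vector +
  fixes scaleC :: "complex \<Rightarrow> 'a \<Rightarrow> 'a"  (infixr "*\<^sub>C" 75)
  assumes scaleC_of_real: "complex_of_real r *\<^sub>C x = r *\<^sub>R x"
    and scaleC_add_right: "a *\<^sub>C (x + y) = a *\<^sub>C x + a *\<^sub>C y"
    and scaleC_add_left: "(a + b) *\<^sub>C x = a *\<^sub>C x + b *\<^sub>C x"
    and scaleC_scaleC: "a *\<^sub>C b *\<^sub>C x = (a * b) *\<^sub>C x"
    and norm_scaleC: "norm (a *\<^sub>C x) = cmod a * norm x"

instantiation complex :: complex_normed_vector
begin

definition scaleC_complex :: "complex \<Rightarrow> complex \<Rightarrow> complex" where
  "scaleC_complex a x = a * x"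

instance
  by standard (simp_all add: scaleC_complex_def scaleR_conv_of_real algebra_simps norm_mult)

end

definition cprod :: "'a::complex_normed_vector \<Rightarrow> 'a \<Rightarrow> complex" where
  "cprod x y =
    (if x = 0 \<or> y = 0 then 0
     else let u = x /\<^sub>R norm x; v = y /\<^sub>R norm y in
       of_real (norm x * norm y) * (1 / 4) *
       (of_real ((norm (u + v))\<^sup>2 - (norm (u - v))\<^sup>2) +
        \<i> * of_real ((norm (u + \<i> *\<^sub>C v))\<^sup>2 - (norm (u - \<i> *\<^sub>C v))\<^sup>2)))"

definition angle_strip :: "complex set" where
  "angle_strip = {z. 0 < Re z \<and> Re z < pi} \<union> {0, of_real pi}"

definition slit_plane :: "complex set" where
  "slit_plane = UNIV - complex_of_real ` {r. r < -1 \<or> r > 1}"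

text \<open>The value outside \<^term>\<open>slit_plane\<close>, the image of \<^term>\<open>angle_strip\<close> under the cosine,
  is unspecified.\<close>

definition carccos :: "complex \<Rightarrow> complex" where
  "carccos = the_inv_into angle_strip cos"

text \<open>Meaningful for nonzero vectors only.\<close>

definition cangle :: "'a::complex_normed_vector \<Rightarrow> 'a \<Rightarrow> complex" where
  "cangle x y = carccos (cprod x y / of_real (norm x * norm y))"

lemma bij_betw_cos_angle_strip: "bij_betw cos angle_strip slit_plane"
proof -
  have inj: "inj_on cos angle_strip"
    by (rule inj_on_inverseI[where g = Arccos], rule Arccos_cos) (auto simp: angle_strip_def)
  have to: "cos z \<in> slit_plane" if z: "z \<in> angle_strip" for z :: complex
  proof (cases "Im (cos z) = 0")
    case False
    then show ?thesis by (auto simp: slit_plane_def)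
  next
    case True
    have "\<bar>Re (cos z)\<bar> \<le> 1"
    proof (cases "0 < Re z \<and> Re z < pi")
      case inside: True
      then have "sin (Re z) > 0" by (simp add: sin_gt_zero)
      with True have "exp (Im z) = exp (- Im z)" by (simp add: Im_cos)
      then have "Im z = 0" by simp
      then show ?thesis by (simp add: Re_cos)
    next
      case False
      then show ?thesis using z by (auto simp: angle_strip_def Re_cos)
    qed
    then show ?thesis by (auto simp: slit_plane_def)
  qed
  have onto: "w \<in> cos ` angle_strip" if w: "w \<in> slit_plane" for w
  proof -
    define z where "z = (if Re (Arccos w) < 0 then - Arccos w else Arccos w)"
    have cz: "cos z = w" by (simp add: z_def)
    have bounds: "0 \<le> Re z" "Re z \<le> pi"
      using Re_Arccos_bounds[of w] by (auto simp: z_def)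
    have "Im z = 0" if edge: "Re z = 0 \<or> Re z = pi"
    proof -
      have re: "\<bar>Re w\<bar> = cosh (Im z)" and im: "Im w = 0"
        using edge exp_gt_zero[of "Im z"] exp_gt_zero[of "- Im z"]
        by (auto simp: cz[symmetric] Re_cos Im_cos cosh_def abs_if simp del: exp_gt_zero)
      have "w = of_real (Re w)" using im by (simp add: complex_eq_iff)
      then have "\<bar>Re w\<bar> \<le> 1" using w by (force simp: slit_plane_def)
      then have "cosh (Im z) = 1" using re cosh_real_ge_1[of "Im z"] by linarith
      then show ?thesis by simp
    qed
    then have "z \<in> angle_strip"
      using bounds by (force simp: angle_strip_def complex_eq_iff)
    then show ?thesis using cz by blast
  qed
  show ?thesis using inj to onto by (auto simp: bij_betw_def)
qed

lemma cprod_div_norms_in_slit_plane: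
  assumes "x \<noteq> 0" "y \<noteq> 0"
  shows "cprod x y / of_real (norm x * norm y) \<in> slit_plane"
proof -
  define u v where "u = x /\<^sub>R norm x" and "v = y /\<^sub>R norm y"
  have n: "norm u = 1" "norm v = 1" using assms by (simp_all add: u_def v_def)
  have "norm (u + v) \<le> 2" "norm (u - v) \<le> 2"
    using norm_triangle_ineq[of u v] norm_triangle_ineq4[of u v] n by simp_all
  then have "(norm (u + v))\<^sup>2 \<le> 4" "(norm (u - v))\<^sup>2 \<le> 4"
    using power_mono[of _ 2 2] by force+
  moreover have "Re (cprod x y / of_real (norm x * norm y)) =
      ((norm (u + v))\<^sup>2 - (norm (u - v))\<^sup>2) / 4"
  proof -
    have "cprod x y / of_real (norm x * norm y) = (1 / 4) *
       (of_real ((norm (u + v))\<^sup>2 - (norm (u - v))\<^sup>2) +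
        \<i> * of_real ((norm (u + \<i> *\<^sub>C v))\<^sup>2 - (norm (u - \<i> *\<^sub>C v))\<^sup>2))"
      using assms by (simp add: cprod_def Let_def u_def v_def)
    then show ?thesis by (simp only:) (simp flip: of_real_power of_real_diff)
  qed
  moreover have "\<bar>(p - q) / 4\<bar> \<le> 1" if "0 \<le> p" "p \<le> 4" "0 \<le> q" "q \<le> 4" for p q :: real
    using that by (simp add: abs_le_iff)
  ultimately have "\<bar>Re (cprod x y / of_real (norm x * norm y))\<bar> \<le> 1"
    by (metis zero_le_power2)
  moreover have "w \<in> slit_plane" if "\<bar>Re w\<bar> \<le> 1" for w
    using that by (auto simp: slit_plane_def)
  ultimately show ?thesis by blast
qed

end

theory Submission
  imports Defs
begin

text \<open>Multiplying \<open>x\<close> by \<open>\<i>\<close> permutes the four norms in the definition of the product, so that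
  \<open>\<langle>\<i>x|y\<rangle> = \<i>\<langle>x|y\<rangle>\<close>. If the cosine \<open>c\<close> of the angle is real, the new cosine is therefore \<open>\<i>c\<close>, and
  \<open>cos (pi/2 + \<i>t) = - \<i> sinh t\<close> gives the new angle \<open>pi/2 - \<i> arsinh c\<close>.\<close>

lemma scaleC_ii_scaleC_ii: "\<i> *\<^sub>C \<i> *\<^sub>C x = - x"
  using scaleC_scaleC[of \<i> \<i> x] scaleC_of_real[of "-1" x] by simp

text \<open>Additivity applied to \<open>(x - y) + y = x\<close>, so that no separate law for
  negatives is needed.\<close>

lemma scaleC_diff_right: "c *\<^sub>C (x - y) = c *\<^sub>C x - c *\<^sub>C y"
  using scaleC_add_right[of c "x - y" y] by (simp add: algebra_simps)

lemma scaleC_scaleR_commute: "c *\<^sub>C r *\<^sub>R x = r *\<^sub>R c *\<^sub>C x"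
  by (simp add: scaleC_of_real[symmetric] scaleC_scaleC mult.commute)

lemma cprod_scaleC_ii: "cprod (\<i> *\<^sub>C x) y = \<i> * cprod x y"
proof (cases "x = 0 \<or> y = 0")
  case True
  then show ?thesis using norm_scaleC[of \<i> x] by (auto simp: cprod_def)
next
  case False
  define u v where "u = x /\<^sub>R norm x" and "v = y /\<^sub>R norm y"
  have norm_ii: "norm (\<i> *\<^sub>C z) = norm z" for z :: 'a
    by (simp add: norm_scaleC)
  have "\<i> *\<^sub>C x \<noteq> 0" using norm_ii[of x] False by auto
  moreover have "(\<i> *\<^sub>C x) /\<^sub>R norm x = \<i> *\<^sub>C u"
    by (simp add: u_def scaleC_scaleR_commute)
  ultimately have cprod_ii: "cprod (\<i> *\<^sub>C x) y = of_real (norm x * norm y) * (1 / 4) *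
      (of_real ((norm (\<i> *\<^sub>C u + v))\<^sup>2 - (norm (\<i> *\<^sub>C u - v))\<^sup>2) +
       \<i> * of_real ((norm (\<i> *\<^sub>C u + \<i> *\<^sub>C v))\<^sup>2 - (norm (\<i> *\<^sub>C u - \<i> *\<^sub>C v))\<^sup>2))"
    using False by (simp add: cprod_def Let_def norm_ii v_def)
  have cprod: "cprod x y = of_real (norm x * norm y) * (1 / 4) *
      (of_real ((norm (u + v))\<^sup>2 - (norm (u - v))\<^sup>2) +
       \<i> * of_real ((norm (u + \<i> *\<^sub>C v))\<^sup>2 - (norm (u - \<i> *\<^sub>C v))\<^sup>2))"
    using False by (simp add: cprod_def Let_def u_def v_def)
  \<comment> \<open>Each of the four arguments is \<open>\<i>\<close> times an argument from
    \<open>cprod\<close>, by \<open>\<i> *\<^sub>C \<i> *\<^sub>C v = - v\<close>, and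
    \<open>\<i>\<close> preserves norms.\<close>
  have "norm (\<i> *\<^sub>C u + v) = norm (u - \<i> *\<^sub>C v)"
    using norm_ii[of "u - \<i> *\<^sub>C v"] by (simp add: scaleC_diff_right scaleC_ii_scaleC_ii)
  moreover have "norm (\<i> *\<^sub>C u - v) = norm (u + \<i> *\<^sub>C v)"
    using norm_ii[of "u + \<i> *\<^sub>C v"] by (simp add: scaleC_add_right scaleC_ii_scaleC_ii)
  moreover have "norm (\<i> *\<^sub>C u + \<i> *\<^sub>C v) = norm (u + v)"
    using norm_ii[of "u + v"] by (simp add: scaleC_add_right)
  moreover have "norm (\<i> *\<^sub>C u - \<i> *\<^sub>C v) = norm (u - v)"
    using norm_ii[of "u - v"] by (simp add: scaleC_diff_right)
  ultimately show ?thesis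
    unfolding cprod_ii cprod by (simp add: algebra_simps)
qed

text \<open>For nonzero vectors the quotient lies in \<open>slit_plane\<close>, where
  \<open>carccos\<close> is a true right inverse of the cosine. This recovers the product from a
  known angle.\<close>

lemma cos_cangle:
  assumes "x \<noteq> 0" "y \<noteq> 0"
  shows "cos (cangle x y) = cprod x y / of_real (norm x * norm y)"
  unfolding cangle_def carccos_def
  by (rule f_the_inv_into_f_bij_betw[OF bij_betw_cos_angle_strip])
    (use cprod_div_norms_in_slit_plane[OF assms] in auto)

lemma carccos_cos: "z \<in> angle_strip \<Longrightarrow> carccos (cos z) = z"
  unfolding carccos_def
  by (rule the_inv_into_f_f) (use bij_betw_cos_angle_strip in \<open>auto simp: bij_betw_def\<close>)

lemma cos_half_pi_plus_ii: "cos (of_real (pi / 2) + \<i> * of_real t) = - \<i> * of_real (sinh t)"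
  by (simp add: complex_eq_iff Re_cos Im_cos sinh_field_def diff_divide_distrib)

lemma carccos_ii_times_real:
  "carccos (\<i> * of_real c) = of_real (pi / 2) - \<i> * of_real (arsinh c)"
proof -
  \<comment> \<open>Solves \<open>- \<i> * sinh t = \<i> * c\<close> for \<open>t\<close>. The real
    part \<open>pi / 2\<close> keeps \<open>z\<close> inside the strip for every real
    \<open>c\<close>.\<close>
  define z where "z = complex_of_real (pi / 2) + \<i> * of_real (arsinh (- c))"
  have "z \<in> angle_strip" by (simp add: z_def angle_strip_def)
  moreover have "cos z = \<i> * of_real c"
    unfolding z_def cos_half_pi_plus_ii by simp
  ultimately show ?thesis using carccos_cos[of z] by (simp add: z_def)
qed

text \<open>This is \<open>cosh (2 * s) = 2 * (sinh s)\<^sup>2 + 1\<close> at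
  \<open>s = arsinh \<bar>c\<bar>\<close>. The absolute value makes \<open>s\<close> nonnegative,
  where \<open>arcosh\<close> inverts \<open>cosh\<close>.\<close>

lemma arcosh_double_square: "arcosh (2 * c\<^sup>2 + 1) = 2 * arsinh \<bar>c\<bar>" for c :: real
proof -
  have "2 * c\<^sup>2 + 1 = cosh (2 * arsinh \<bar>c\<bar>)"
    by (simp add: cosh_double cosh_arsinh_real)
  moreover have "0 \<le> arsinh \<bar>c\<bar>"
    using arsinh_real_neg_iff[of "\<bar>c\<bar>"] by linarith
  ultimately show ?thesis by (simp add: arcosh_cosh_real)
qed

theorem corollary1p5:
  fixes x y :: "'a::complex_normed_vector" and a :: real
  assumes "x \<noteq> 0" and "y \<noteq> 0"
    and "- (pi / 2) \<le> a" and "a \<le> pi / 2"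
    and "cangle x y = complex_of_real (pi / 2 + a)"
  shows "Re (cangle (\<i> *\<^sub>C x) y) = pi / 2
    \<and> cangle (\<i> *\<^sub>C x) y = complex_of_real (pi / 2)
        + \<i> * complex_of_real (1 / 2 * sgn a * arcosh (2 * (cos (pi / 2 + a))\<^sup>2 + 1))
    \<and> cangle (\<i> *\<^sub>C x) y = complex_of_real (pi / 2)
        + \<i> * complex_of_real (sgn a * ln (sqrt ((cos (pi / 2 + a))\<^sup>2 + 1) + \<bar>cos (pi / 2 + a)\<bar>))"
proof -
  define c where "c = cos (pi / 2 + a)"
  have c: "c = - sin a" by (simp add: c_def cos_add)
  have "cprod x y / of_real (norm x * norm y) = of_real c"
    using cos_cangle[of x y] assms by (simp add: c_def cos_of_real del: of_real_add)
  then have "cprod (\<i> *\<^sub>C x) y / of_real (norm (\<i> *\<^sub>C x) * norm y) = \<i> * of_real c"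
    by (simp add: cprod_scaleC_ii norm_scaleC flip: times_divide_eq_right)
  then have angle: "cangle (\<i> *\<^sub>C x) y = of_real (pi / 2) - \<i> * of_real (arsinh c)"
    unfolding cangle_def by (simp only: carccos_ii_times_real)
  \<comment> \<open>On \<open>[-pi/2, pi/2]\<close> the sine has the sign of \<open>a\<close>, so
    \<open>c = - sin a\<close> has the opposite sign, and \<open>arsinh\<close> is odd. At
    \<open>a = 0\<close> both sides vanish.\<close>
  have "- arsinh c = sgn a * arsinh \<bar>c\<bar>"
  proof (cases a "0::real" rule: linorder_cases)
    case less
    then have "0 < sin (- a)" using assms by (intro sin_gt_zero) auto
    then show ?thesis using less by (simp add: c)
  next
    case greater
    then have "0 < sin a" using assms by (intro sin_gt_zero) auto
    then show ?thesis using greater by (simp add: c)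
  qed (simp add: c)
  \<comment> \<open>Both closed forms rewrite this one: the factor \<open>1 / 2\<close> cancels the
    2 from \<open>arcosh_double_square\<close>, and the logarithm is the definition of
    \<open>arsinh\<close>.\<close>
  then have "cangle (\<i> *\<^sub>C x) y = of_real (pi / 2) + \<i> * of_real (sgn a * arsinh \<bar>c\<bar>)"
    unfolding angle by (metis diff_conv_add_uminus mult_minus_right of_real_minus)
  moreover have "arsinh \<bar>c\<bar> = ln (sqrt (c\<^sup>2 + 1) + \<bar>c\<bar>)"
    by (simp add: arsinh_real_def add.commute)
  ultimately show ?thesis
    unfolding c_def[symmetric] arcosh_double_square by simp
qed

end
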